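(* Let $n\in\mathbb{N}$ and let $(u^{(k)})$, $(v^{(k)})$ be the sequences with $u^{(0)}=v^{(0)}=x^{(0)}$ and, for all $k<n$, $$v^{(k+1)}=v^{(k)}+P^{-1}A(x^\infty-v^{(k)}),$$ $$u^{(k+1)}=u^{(k)}+Q_u^{(k)}(x^\infty-u^{(k)})+P^{-1}A(\mathrm{Id}-Q_u^{(k)})(x^\infty-u^{(k)}).$$ Define $$v^{(n+1/2)}=(\mathrm{Id}-Q_v^{(n)})v^{(n)}+Q_v^{(n)}x^\infty,\quad u^{(n+1/2)}=(\mathrm{Id}-Q_u^{(n)})u^{(n)}+Q_u^{(n)}x^\infty,\quad x^{(1/2)}=(\mathrm{Id}-Q_x^{(n)})x^{(0)}+Q_x^{(n)}x^\infty .$$ Then, for all $n\in\mathbb{N}$, $v^{(n+1/2)}=u^{(n+1/2)}=x^{(1/2)}$.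
   Context: $A,P\in GL_N(\mathbb{R})$, $b\in\mathbb{R}^N$, $x^\infty$ is the solution of $Ax^\infty=b$, and $x^{(0)}\in\mathbb{R}^N$ is an initial guess. Projections based on a linear operator $L$: fix a linear operator $L$ on $\mathbb{R}^N$. For a subspace $\mathbf{Z}$ with basis given by the columns of a matrix $Z$, put $\mathbf{Y}=L\mathbf{Z}$, with basis the columns of a matrix $Y$; the projection onto $\mathbf{Z}$ based on $L$ is $Q=Z(Y^TAZ)^{-1}Y^TA$, i.e. the projection onto $\mathbf{Z}$ with $\langle AQx,y\rangle=\langle Ax,y\rangle$ for all $x\in\mathbb{R}^N$, $y\in\mathbf{Y}$. All projections occurring below are assumed to be well defined ($Q=0$ if $\mathbf{Z}=\{0\}$) and are based on the same $L$. $Q_u^{(k)}$ is the projection onto $\mathbf{Z}_u^{(k)}=\mathrm{span}(u^{(i)}-u^{(i-1)})_{1\le i\le k}$ for $k\le n$; $Q_v^{(n)}$ is the projection onto $\mathbf{Z}_v^{(n)}=\mathrm{span}(v^{(i)}-v^{(i-1)})_{1\le i\le n}$; $Q_x^{(n)}$ is the projection onto the Krylov subspace $\mathbb{K}^n=\mathrm{span}\{\tilde r_0,P^{-1}A\tilde r_0,\dots,(P^{-1}A)^{n-1}\tilde r_0\}$, where $\tilde r_0=P^{-1}A(x^\infty-x^{(0)})$.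
   Formalization: The equalities involving u^(n+1/2) are proved under the added condition that, for k<n, u^(k+1)=u^(k) only if u^(k)=x^∞; without it they can fail (P=Id, A=L a plane rotation by 90°, n=2). The equality v^(n+1/2)=x^(1/2) needs no added condition. *)

theory Defs
  imports "HOL-Analysis.Analysis"
begin

(* The number of columns of Z varies with the subspace, so it cannot be a type-level dimension.
   An N x m matrix is represented by its columns z 0, ..., z (m - 1). *)

definition column_basis :: "nat \<Rightarrow> (nat \<Rightarrow> real ^ 'n) \<Rightarrow> (real ^ 'n) set \<Rightarrow> bool" where
  "column_basis m z S \<longleftrightarrow>
     inj_on z {..<m} \<and> independent (z ` {..<m}) \<and> span (z ` {..<m}) = S"

definition inverse_entries ::
    "nat \<Rightarrow> (nat \<Rightarrow> nat \<Rightarrow> real) \<Rightarrow> (nat \<Rightarrow> nat \<Rightarrow> real) \<Rightarrow> bool" where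
  "inverse_entries m M G \<longleftrightarrow>
     (\<forall>i<m. \<forall>j<m. (\<Sum>l<m. M i l * G l j) = (if i = j then 1 else 0)) \<and>
     (\<forall>i<m. \<forall>j<m. (\<Sum>l<m. G i l * M l j) = (if i = j then 1 else 0))"

(* "The projection onto S based on L is well defined and equals Q": Q = Z (Y^T A Z)^{-1} Y^T A for
   bases Z of S and Y of L S.  Y^T A Z has entries y_i . A z_j and G is its inverse.  The bases
   have the same length m because Y^T A Z must be square.  For S = {0} necessarily m = 0 and
   Q = 0.  The lemmas below show that Q does not depend on the bases. *)
definition is_projection_based_on ::
    "real ^ 'n ^ 'n \<Rightarrow> (real ^ 'n \<Rightarrow> real ^ 'n) \<Rightarrow> (real ^ 'n) set
      \<Rightarrow> (real ^ 'n \<Rightarrow> real ^ 'n) \<Rightarrow> bool" where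
  "is_projection_based_on A L S Q \<longleftrightarrow>
     (\<exists>m z y G. column_basis m z S \<and> column_basis m y (L ` S) \<and>
        inverse_entries m (\<lambda>i j. y i \<bullet> (A *v z j)) G \<and>
        (\<forall>x. Q x = (\<Sum>i<m. (\<Sum>j<m. G i j * (y j \<bullet> (A *v x))) *\<^sub>R z i)))"

definition increment_space :: "(nat \<Rightarrow> real ^ 'n) \<Rightarrow> nat \<Rightarrow> (real ^ 'n) set" where
  "increment_space u k = span ((\<lambda>i. u i - u (i - 1)) ` {1..k})"

definition krylov_space :: "real ^ 'n ^ 'n \<Rightarrow> real ^ 'n \<Rightarrow> nat \<Rightarrow> (real ^ 'n) set" where
  "krylov_space M r k = span ((\<lambda>i. (((*v) M) ^^ i) r) ` {..<k})"

lemma is_projection_based_on_galerkin: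
  assumes "is_projection_based_on A L S Q"
  shows "Q x \<in> S"
    and "y \<in> L ` S \<Longrightarrow> (A *v Q x) \<bullet> y = (A *v x) \<bullet> y"
    and "w \<in> S \<Longrightarrow> Q w = w"
proof -
  obtain m z y' G where z: "column_basis m z S" and y: "column_basis m y' (L ` S)"
    and G: "inverse_entries m (\<lambda>i j. y' i \<bullet> (A *v z j)) G"
    and Q: "\<And>x. Q x = (\<Sum>i<m. (\<Sum>j<m. G i j * (y' j \<bullet> (A *v x))) *\<^sub>R z i)"
    using assms unfolding is_projection_based_on_def by blast
  show "Q x \<in> S"
    unfolding Q using z unfolding column_basis_def
    by (auto intro!: span_sum span_scale intro: span_base)
  have lin: "linear Q"
    unfolding Q
    by (intro linearI)
      (simp_all add: Q matrix_vector_right_distrib inner_add_right algebra_simps sum.distrib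
        matrix_vector_mult_scaleR scaleR_sum_right sum_distrib_left scaleR_add_left)
  have Qz: "Q (z k) = z k" if "k < m" for k
  proof -
    have "Q (z k) = (\<Sum>i<m. (if i = k then 1 else 0) *\<^sub>R z i)"
      unfolding Q using G that unfolding inverse_entries_def by (intro sum.cong) auto
    also have "\<dots> = (\<Sum>i<m. if i = k then z i else 0)"
      by (intro sum.cong) auto
    finally show ?thesis using that by simp
  qed
  show "Q w = w" if "w \<in> S"
  proof -
    have "w \<in> span (z ` {..<m})" using that z by (simp add: column_basis_def)
    then show ?thesis
      using linear_eq_on[OF lin linear_id[unfolded id_def], of w "z ` {..<m}"] Qz by auto
  qed
  have base: "y' k \<bullet> (A *v Q x) = y' k \<bullet> (A *v x)" if "k < m" for k
  proof -
    have "y' k \<bullet> (A *v Q x)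
        = (\<Sum>i<m. (\<Sum>j<m. G i j * (y' j \<bullet> (A *v x))) * (y' k \<bullet> (A *v z i)))"
      unfolding Q
      by (simp add: linear_sum[OF matrix_vector_mul_linear] inner_sum_right
          matrix_vector_mult_scaleR)
    also have "\<dots> = (\<Sum>j<m. (\<Sum>i<m. (y' k \<bullet> (A *v z i)) * G i j) * (y' j \<bullet> (A *v x)))"
      unfolding sum_distrib_right
      by (subst sum.swap) (simp add: mult_ac)
    also have "\<dots> = (\<Sum>j<m. (if k = j then 1 else 0) * (y' j \<bullet> (A *v x)))"
      using G that unfolding inverse_entries_def by (intro sum.cong) auto
    also have "\<dots> = (\<Sum>j<m. if j = k then y' j \<bullet> (A *v x) else 0)"
      by (intro sum.cong) auto
    finally show ?thesis using that by simp
  qed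
  show "(A *v Q x) \<bullet> y = (A *v x) \<bullet> y" if "y \<in> L ` S"
  proof -
    have "y \<in> span (y' ` {..<m})" using that y by (simp add: column_basis_def)
    then show ?thesis
    proof (induction rule: span_induct_alt)
      case base
      then show ?case by simp
    next
      case (step c a b)
      then show ?case using base by (auto simp: inner_add_right inner_commute)
    qed
  qed
qed

lemma is_projection_based_on_unique:
  assumes Q: "is_projection_based_on A L S Q"
    and Q': "\<And>x. Q' x \<in> S" "\<And>x y. y \<in> L ` S \<Longrightarrow> (A *v Q' x) \<bullet> y = (A *v x) \<bullet> y"
  shows "Q' = Q"
proof
  fix x
  obtain m z y G where yb: "column_basis m y (L ` S)"
    and Qdef: "\<And>x. Q x = (\<Sum>i<m. (\<Sum>j<m. G i j * (y j \<bullet> (A *v x))) *\<^sub>R z i)"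
    using Q unfolding is_projection_based_on_def by blast
  have "y j \<in> L ` S" if "j < m" for j
    using yb that unfolding column_basis_def by (metis imageI lessThan_iff span_base)
  then have "y j \<bullet> (A *v Q' x) = y j \<bullet> (A *v x)" if "j < m" for j
    using Q'(2) that by (simp add: inner_commute)
  then have "Q (Q' x) = Q x"
    unfolding Qdef by (intro sum.cong) auto
  then show "Q' x = Q x"
    using is_projection_based_on_galerkin(3)[OF Q Q'(1)] by simp
qed

end

theory Submission
  imports Defs
begin

text \<open>
  Write \<open>M = P\<^sup>-\<^sup>1 A\<close>, \<open>e\<^sub>0 = xinf - x0\<close>, \<open>r = M e\<^sub>0\<close> and \<open>K\<^sub>k\<close> for the Krylov space of dimension at
  most \<open>k\<close> generated by \<open>r\<close>.  If \<open>Q\<close> is a projection onto \<open>S\<close>, then the point \<open>w + Q (xinf - w)\<close>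
  depends only on the class of \<open>w\<close> modulo \<open>S\<close> (\<open>correction_cong\<close>).  Each iterate differs from \<open>x0\<close>
  by an element of its own increment space, and the projection onto a given space is unique, so
  both equalities follow once the increment spaces are identified with Krylov spaces.

  For the unaccelerated iteration \<open>v\<close> the increments satisfy \<open>d\<^sub>j\<^sub>+\<^sub>1 = d\<^sub>j - M d\<^sub>j\<close>, so both flags of
  spaces grow by applying \<open>M\<close> and start from the same vector \<open>d\<^sub>0 = r\<close>
  (\<open>richardson_increment_space\<close>).

  For the accelerated iteration \<open>u\<close> the new increment \<open>d\<^sub>k\<close> lies in \<open>K\<^sub>k\<^sub>+\<^sub>1\<close>, and if it lies
  outside \<open>K\<^sub>k\<close>, then the exchange lemma gives equality of the spaces at level \<open>k + 1\<close>.  The critical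
  case is \<open>d\<^sub>k \<in> K\<^sub>k\<close> while \<open>K\<^sub>k\<close> is strictly smaller than \<open>K\<^sub>k\<^sub>+\<^sub>1\<close>.  For \<open>k = 0\<close> it means
  \<open>d\<^sub>0 = 0\<close>.  For \<open>k > 0\<close> the residual error
  \<open>f = e\<^sub>0 - Q\<^sub>k e\<^sub>0\<close> satisfies \<open>M f \<in> K\<^sub>k\<close>, which forces \<open>Q\<^sub>k e\<^sub>0\<close> into \<open>K\<^sub>k\<^sub>-\<^sub>1\<close>; hence \<open>f\<close> was already
  the residual error one step earlier, and the step made then has put the error into the form
  \<open>f - M f\<close>.  Its projection is \<open>- M f\<close>, because \<open>Q\<^sub>k f = 0\<close> and
  \<open>M f \<in> K\<^sub>k\<close>, while the residual step adds \<open>M f\<close>; therefore \<open>d\<^sub>k = 0\<close>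
  (\<open>accelerated_stagnation\<close>).  So the only obstruction
  to \<open>increment_space u k = K\<^sub>k\<close> is stagnation.  Stagnation at the solution is harmless: it puts
  \<open>e\<^sub>0\<close> into \<open>K\<^sub>k\<close>, and then injectivity of \<open>M\<close> makes the Krylov spaces stationary from \<open>k\<close> on
  (\<open>krylov_space_stationary\<close>).
\<close>

section \<open>Projections based on a linear operator\<close>

lemma projection_based_on_linear:
  fixes A :: "real ^ 'n ^ 'n"
  assumes "is_projection_based_on A L S Q"
  shows "linear Q"
proof -
  obtain m z y G where "column_basis m z S"
    and Q: "\<And>x. Q x = (\<Sum>i<m. (\<Sum>j<m. G i j * (y j \<bullet> (A *v x))) *\<^sub>R z i)"
    using assms unfolding is_projection_based_on_def by blast
  show ?thesis
    by (intro linearI)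
      (simp_all add: Q matrix_vector_right_distrib inner_add_right algebra_simps sum.distrib
        matrix_vector_mult_scaleR scaleR_sum_right sum_distrib_left scaleR_add_left)
qed

lemma projection_based_on_eq_0:
  assumes Q: "is_projection_based_on A L S Q"
    and orth: "\<And>y. y \<in> L ` S \<Longrightarrow> (A *v x) \<bullet> y = 0"
  shows "Q x = 0"
proof -
  obtain m z y G where y: "column_basis m y (L ` S)"
    and Q: "\<And>x. Q x = (\<Sum>i<m. (\<Sum>j<m. G i j * (y j \<bullet> (A *v x))) *\<^sub>R z i)"
    using Q unfolding is_projection_based_on_def by blast
  have "y j \<in> L ` S" if "j < m" for j
    using y that unfolding column_basis_def by (metis imageI lessThan_iff span_base)
  then have "y j \<bullet> (A *v x) = 0" if "j < m" for j
    using orth that by (simp add: inner_commute)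
  then show ?thesis
    unfolding Q by simp
qed

lemma projection_based_on_inj:
  assumes "is_projection_based_on A L S Q" and "is_projection_based_on A L S Q'"
  shows "Q = Q'"
  using is_projection_based_on_unique[OF assms(2)] is_projection_based_on_galerkin(1,2)[OF assms(1)]
  by blast

text \<open>A linear map that is the identity on \<open>S\<close> moves \<open>w\<close> and \<open>Q w\<close> by the same amount when \<open>w\<close>
  changes by an element of \<open>S\<close>.\<close>

lemma correction_cong:
  assumes Q: "is_projection_based_on A L S Q" and "w - w' \<in> S"
  shows "w - Q w = w' - Q w'"
proof -
  have "Q (w - w') = w - w'"
    using is_projection_based_on_galerkin(3)[OF Q assms(2)] .
  then show ?thesis
    by (simp add: linear_diff[OF projection_based_on_linear[OF Q]] algebra_simps)
qed

text \<open>The Galerkin conditions for a larger space contain those for a smaller one, so a projection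
  that happens to land in the smaller space is the projection onto it.\<close>

lemma projection_based_on_subspace:
  assumes Q: "is_projection_based_on A L S Q" and Q': "is_projection_based_on A L S' Q'"
    and "S' \<subseteq> S" and "Q x \<in> S'"
  shows "Q' x = Q x"
proof -
  have "Q' (x - Q x) = 0"
    using is_projection_based_on_galerkin(2)[OF Q] \<open>S' \<subseteq> S\<close>
    by (intro projection_based_on_eq_0[OF Q'])
      (auto simp: matrix_vector_mult_diff_distrib inner_diff_left)
  moreover have "Q' (Q x) = Q x"
    using is_projection_based_on_galerkin(3)[OF Q'] assms(4) by blast
  ultimately show ?thesis
    by (simp add: linear_diff[OF projection_based_on_linear[OF Q']])
qed

section \<open>Increment spaces and Krylov spaces\<close>

lemma span_insert_span: "span (insert a (span S)) = span (insert a S)"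
  by (simp add: span_insert span_span)

lemma increment_space_0: "increment_space u 0 = {0}"
  by (simp add: increment_space_def)

lemma subspace_increment_space: "subspace (increment_space u k)"
  by (simp add: increment_space_def)

lemma increment_space_Suc:
  "increment_space u (Suc k) = span (insert (u (Suc k) - u k) (increment_space u k))"
  unfolding increment_space_def span_insert_span
  by (simp add: atLeastAtMostSuc_conv)

lemma increment_mem_increment_space: "j < k \<Longrightarrow> u (Suc j) - u j \<in> increment_space u k"
  unfolding increment_space_def
  by (rule span_base, rule image_eqI[of _ _ "Suc j"]) auto

lemma diff_mem_increment_space: "u k - u 0 \<in> increment_space u k"
proof (induction k)
  case 0
  then show ?case by (simp add: increment_space_0)
next
  case (Suc k)
  have "(u (Suc k) - u k) + (u k - u 0) \<in> increment_space u (Suc k)"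
    unfolding increment_space_Suc by (intro span_add span_base) (use Suc in auto)
  then show ?case by simp
qed

lemma krylov_space_0: "krylov_space M r 0 = {0}"
  by (simp add: krylov_space_def)

lemma subspace_krylov_space: "subspace (krylov_space M r k)"
  by (simp add: krylov_space_def)

lemma krylov_space_Suc:
  "krylov_space M r (Suc k) = span (insert ((((*v) M) ^^ k) r) (krylov_space M r k))"
  unfolding krylov_space_def span_insert_span by (simp add: lessThan_Suc)

lemma krylov_space_subset_Suc: "krylov_space M r k \<subseteq> krylov_space M r (Suc k)"
  unfolding krylov_space_Suc by (auto intro: span_base)

lemma power_mem_krylov_space: "j < k \<Longrightarrow> (((*v) M) ^^ j) r \<in> krylov_space M r k"
  unfolding krylov_space_def by (auto intro: span_base)

lemma image_krylov_space:
  "((*v) M) ` krylov_space M r k = span ((\<lambda>i. (((*v) M) ^^ Suc i) r) ` {..<k})"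
  unfolding krylov_space_def
  by (simp add: linear_span_image[OF matrix_vector_mul_linear, symmetric] image_image)

lemma mult_mem_krylov_space:
  assumes "w \<in> krylov_space M r k"
  shows "M *v w \<in> krylov_space M r (Suc k)"
proof -
  have "M *v w \<in> span ((\<lambda>i. (((*v) M) ^^ Suc i) r) ` {..<k})"
    using assms image_krylov_space[of M r k] by blast
  also have "\<dots> \<subseteq> krylov_space M r (Suc k)"
    by (intro span_minimal subspace_krylov_space) (auto intro: power_mem_krylov_space simp del: funpow.simps)
  finally show ?thesis .
qed

lemma krylov_space_invariant_step:
  assumes "(((*v) M) ^^ k) r \<in> krylov_space M r k"
  shows "krylov_space M r (Suc k) = krylov_space M r k"
  unfolding krylov_space_Suc
  using assms by (simp add: insert_absorb span_eq_iff[THEN iffD2, OF subspace_krylov_space])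

text \<open>Let \<open>W\<close> be the \<open>k\<close>-th Krylov space of \<open>e\<close>, so that \<open>M W\<close> is that of \<open>M e\<close>.  The hypothesis
  \<open>e \<in> M W\<close> gives \<open>W \<subseteq> M W\<close>.  An injective \<open>M\<close> preserves dimension, so \<open>M W = W\<close>, and all
  powers of \<open>M\<close> map \<open>W\<close> to itself.\<close>

lemma krylov_space_stationary:
  assumes inj: "inj ((*v) M)" and e: "e \<in> krylov_space M (M *v e) k"
  shows "(((*v) M) ^^ k) (M *v e) \<in> krylov_space M (M *v e) k"
proof -
  let ?W = "krylov_space M e k"
  have shift: "krylov_space M (M *v e) k = ((*v) M) ` ?W"
    unfolding image_krylov_space unfolding krylov_space_def by (simp add: funpow_swap1)
  have "(((*v) M) ^^ i) e \<in> ((*v) M) ` ?W" if "i < k" for i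
  proof (cases i)
    case 0
    then show ?thesis using e shift by simp
  next
    case (Suc j)
    then show ?thesis
      using that power_mem_krylov_space[of j k M e] by simp
  qed
  then have "?W \<subseteq> ((*v) M) ` ?W"
    by (subst (1) krylov_space_def, intro span_minimal linear_subspace_image
        matrix_vector_mul_linear subspace_krylov_space) auto
  moreover have "dim (((*v) M) ` ?W) = dim ?W"
    by (rule dim_image_eq) (use inj in \<open>auto intro: inj_on_subset\<close>)
  ultimately have "((*v) M) ` ?W = ?W"
    by (intro subspace_dim_equal[symmetric] linear_subspace_image
        matrix_vector_mul_linear subspace_krylov_space) auto
  then have fixed: "krylov_space M (M *v e) k = ?W" and MW: "\<And>w. w \<in> ?W \<Longrightarrow> M *v w \<in> ?W"
    using shift by auto
  have "(((*v) M) ^^ j) (M *v e) \<in> ?W" for j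
    by (induction j) (use e fixed MW in auto)
  then show ?thesis
    by (simp add: fixed)
qed

text \<open>The coefficient of \<open>M\<^sup>k r\<close> in \<open>q\<close> reappears as the coefficient of the new vector \<open>M\<^sup>k\<^sup>+\<^sup>1 r\<close> in
  \<open>M q\<close>, where it has to vanish.\<close>

lemma krylov_space_degree_drop:
  assumes q: "q \<in> krylov_space M r (Suc k)" and Mq: "M *v q \<in> krylov_space M r (Suc k)"
    and new: "(((*v) M) ^^ Suc k) r \<notin> krylov_space M r (Suc k)"
  shows "q \<in> krylov_space M r k"
proof -
  let ?K = "krylov_space M r (Suc k)"
  obtain c where c: "q - c *\<^sub>R (((*v) M) ^^ k) r \<in> krylov_space M r k"
    using q unfolding krylov_space_Suc span_insert
    by (auto simp: span_eq_iff[THEN iffD2, OF subspace_krylov_space])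
  have "M *v q - M *v (q - c *\<^sub>R (((*v) M) ^^ k) r) \<in> ?K"
    using Mq mult_mem_krylov_space[OF c] by (rule subspace_diff[OF subspace_krylov_space])
  then have *: "c *\<^sub>R (((*v) M) ^^ Suc k) r \<in> ?K"
    by (simp add: matrix_vector_mult_diff_distrib matrix_vector_mult_scaleR)
  have "c = 0"
  proof (rule ccontr)
    assume "c \<noteq> 0"
    then show False
      using new subspace_scale[OF subspace_krylov_space *, of "inverse c"] by simp
  qed
  then show ?thesis using c by simp
qed

section \<open>The increment spaces of the two iterations\<close>

text \<open>The increments satisfy \<open>M d\<^sub>j = d\<^sub>j - d\<^sub>j\<^sub>+\<^sub>1\<close>, so \<open>M\<close> raises the level in the flag of increment
  spaces by one, exactly as it does for the Krylov spaces.\<close>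

lemma richardson_increment_space:
  assumes step: "\<And>k. k < n \<Longrightarrow> v (Suc k) = v k + M *v (xinf - v k)" and "k \<le> n"
  shows "increment_space v k = krylov_space M (M *v (xinf - v 0)) k"
  using \<open>k \<le> n\<close>
proof (induction k)
  case 0
  then show ?case by (simp add: increment_space_0 krylov_space_0)
next
  case (Suc k)
  let ?r = "M *v (xinf - v 0)"
  let ?K = "krylov_space M ?r"
  have IH: "increment_space v k = ?K k" using Suc by simp
  have d: "v (Suc j) - v j = M *v (xinf - v j)" if "j \<le> k" for j
    using step[of j] that Suc.prems by simp
  have "?r - M *v (v k - v 0) \<in> ?K (Suc k)"
  proof (rule subspace_diff[OF subspace_krylov_space])
    show "?r \<in> ?K (Suc k)"
      using power_mem_krylov_space[of 0 "Suc k" M ?r] by simp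
    show "M *v (v k - v 0) \<in> ?K (Suc k)"
      using diff_mem_increment_space[of v k] IH by (intro mult_mem_krylov_space) simp
  qed
  then have "v (Suc k) - v k \<in> ?K (Suc k)"
    by (simp add: d matrix_vector_mult_diff_distrib)
  then have le: "increment_space v (Suc k) \<subseteq> ?K (Suc k)"
    unfolding increment_space_Suc IH
    using krylov_space_subset_Suc by (intro span_minimal subspace_krylov_space) auto
  have raise: "M *v w \<in> increment_space v (Suc k)" if "w \<in> increment_space v k" for w
  proof -
    have gen: "M *v (v (Suc j) - v j) \<in> increment_space v (Suc k)" if "j < k" for j
    proof -
      have "(v (Suc j) - v j) - (v (Suc (Suc j)) - v (Suc j))
          = M *v (xinf - v j) - M *v (xinf - v (Suc j))"
        using that by (simp only: d less_imp_le Suc_leI)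
      also have "\<dots> = M *v (v (Suc j) - v j)"
        by (simp add: matrix_vector_mult_diff_distrib)
      finally have "M *v (v (Suc j) - v j) = (v (Suc j) - v j) - (v (Suc (Suc j)) - v (Suc j))" ..
      then show ?thesis
        using that
        by (simp only:) (rule subspace_diff[OF subspace_increment_space];
            rule increment_mem_increment_space; simp)
    qed
    have sub: "subspace {x. M *v x \<in> increment_space v (Suc k)}"
      using linear_subspace_vimage[OF matrix_vector_mul_linear subspace_increment_space, of M]
      by (simp add: vimage_def)
    have "v i - v (i - 1) \<in> {x. M *v x \<in> increment_space v (Suc k)}" if i: "i \<in> {1..k}" for i
    proof -
      obtain j where "i = Suc j" "j < k" using i by (cases i) auto
      then show ?thesis using gen by simp
    qed
    then have "increment_space v k \<subseteq> {x. M *v x \<in> increment_space v (Suc k)}"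
      by (subst increment_space_def, intro span_minimal sub) blast
    then show ?thesis using that by blast
  qed
  have "(((*v) M) ^^ k) ?r \<in> increment_space v (Suc k)"
  proof (cases k)
    case 0
    then show ?thesis
      using increment_mem_increment_space[of 0 "Suc 0" v] d[of 0] by simp
  next
    case (Suc j)
    then show ?thesis
      using raise[of "(((*v) M) ^^ j) ?r"] IH power_mem_krylov_space[of j k M ?r] by simp
  qed
  moreover have "?K k \<subseteq> increment_space v (Suc k)"
    unfolding IH[symmetric] increment_space_Suc by (auto intro: span_base)
  ultimately have "?K (Suc k) \<subseteq> increment_space v (Suc k)"
    unfolding krylov_space_Suc by (intro span_minimal subspace_increment_space) auto
  with le show ?case by blast
qed

text \<open>The critical case of the induction for \<open>u\<close>: the new increment lies in the old space although
  the Krylov space grows.  Since \<open>M f\<close> is then in \<open>K\<^sub>k\<close>, the last two residual errors coincide, and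
  the projection at level \<open>k\<close> undoes exactly the preceding step.\<close>

lemma accelerated_stagnation:
  assumes Qu: "\<And>j. j \<le> k \<Longrightarrow> is_projection_based_on A L (increment_space u j) (Qu j)"
    and step: "\<And>j. j \<le> k \<Longrightarrow>
          u (Suc j) = u j + Qu j (xinf - u j) + M *v ((xinf - u j) - Qu j (xinf - u j))"
    and K: "\<And>j. j \<le> k \<Longrightarrow> increment_space u j = krylov_space M (M *v (xinf - u 0)) j"
    and old: "u (Suc k) - u k \<in> increment_space u k"
    and new: "(((*v) M) ^^ k) (M *v (xinf - u 0)) \<notin> krylov_space M (M *v (xinf - u 0)) k"
  shows "u (Suc k) = u k"
proof (cases k)
  case 0
  then show ?thesis using old by (simp add: increment_space_0)
next
  case (Suc j)
  let ?e = "xinf - u 0"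
  let ?r = "M *v ?e"
  let ?K = "krylov_space M ?r"
  define f where "f = ?e - Qu k ?e"
  \<comment> \<open>After projection the error at step \<open>i\<close> no longer depends on the path taken to \<open>u i\<close>.\<close>
  have residual: "(xinf - u i) - Qu i (xinf - u i) = ?e - Qu i ?e" if "i \<le> k" for i
  proof (rule correction_cong[OF Qu[OF that]])
    have "- (u i - u 0) \<in> increment_space u i"
      by (intro subspace_neg[OF subspace_increment_space] diff_mem_increment_space)
    then show "(xinf - u i) - ?e \<in> increment_space u i" by simp
  qed
  have QK: "Qu k x \<in> ?K k" for x
    using is_projection_based_on_galerkin(1)[OF Qu[of k]] K by simp
  have Mf_eq: "M *v f = (u (Suc k) - u k) - Qu k (xinf - u k)"
    using step[of k] residual[of k] by (simp add: f_def)
  then have Mf: "M *v f \<in> ?K k"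
    using old QK K[of k] unfolding Mf_eq
    by (intro subspace_diff[OF subspace_krylov_space, of "u (Suc k) - u k"]) simp_all
  have "?r \<in> ?K k"
    using power_mem_krylov_space[of 0 k M ?r] Suc by simp
  then have "?r - M *v f \<in> ?K k"
    using Mf by (rule subspace_diff[OF subspace_krylov_space])
  then have "M *v Qu k ?e \<in> ?K k"
    by (simp add: f_def matrix_vector_mult_diff_distrib)
  then have "Qu k ?e \<in> ?K j"
    using krylov_space_degree_drop[of "Qu k ?e" M ?r j] QK new Suc by simp
  then have "Qu j ?e = Qu k ?e"
    using krylov_space_subset_Suc[of M ?r j] K Suc
    by (intro projection_based_on_subspace[OF Qu[of k] Qu[of j]]) auto
  then have fj: "(xinf - u j) - Qu j (xinf - u j) = f"
    using residual[of j] Suc by (simp add: f_def)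
  \<comment> \<open>The step from \<open>j\<close> to \<open>k\<close> therefore used the same \<open>f\<close> as the step from \<open>k\<close> does.\<close>
  then have "u k = u j + Qu j (xinf - u j) + M *v f"
    using step[of j] Suc by simp
  then have "xinf - u k = ((xinf - u j) - Qu j (xinf - u j)) - M *v f"
    by simp
  then have error: "xinf - u k = f - M *v f"
    unfolding fj .
  have lin: "linear (Qu k)"
    using projection_based_on_linear[OF Qu[of k]] by simp
  have idem: "w \<in> ?K k \<Longrightarrow> Qu k w = w" for w
    using is_projection_based_on_galerkin(3)[OF Qu[of k]] K by simp
  have "Qu k f = 0"
    by (simp add: f_def linear_diff[OF lin] idem[OF QK])
  then have "Qu k (xinf - u k) = - (M *v f)"
    using idem[OF Mf] by (simp add: error linear_diff[OF lin])
  then show ?thesis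
    using Mf_eq by simp
qed

text \<open>A growing Krylov space with an old increment would mean stagnation at \<open>xinf\<close>, hence
  \<open>e\<^sub>0 \<in> K\<^sub>k\<close>, which contradicts the growth.\<close>

lemma accelerated_increment_space:
  assumes inj: "inj ((*v) M)"
    and Qu: "\<And>k. k \<le> n \<Longrightarrow> is_projection_based_on A L (increment_space u k) (Qu k)"
    and step: "\<And>k. k < n \<Longrightarrow>
          u (Suc k) = u k + Qu k (xinf - u k) + M *v ((xinf - u k) - Qu k (xinf - u k))"
    and nostag: "\<And>k. k < n \<Longrightarrow> u (Suc k) = u k \<Longrightarrow> u k = xinf"
    and "k \<le> n"
  shows "increment_space u k = krylov_space M (M *v (xinf - u 0)) k"
  using \<open>k \<le> n\<close>
proof (induction k rule: less_induct)
  case (less k')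
  let ?e = "xinf - u 0"
  let ?r = "M *v ?e"
  let ?K = "krylov_space M ?r"
  show ?case
  proof (cases k')
    case 0
    then show ?thesis by (simp add: increment_space_0 krylov_space_0)
  next
    case (Suc k)
    have kn: "k < n" using Suc less.prems by simp
    have IH: "increment_space u j = ?K j" if "j \<le> k" for j
      using less that Suc by simp
    have Q: "is_projection_based_on A L (?K k) (Qu k)"
      using Qu[of k] IH kn by simp
    have u0: "u k - u 0 \<in> ?K k"
      using diff_mem_increment_space[of u k] IH by simp
    define d where "d = u (Suc k) - u k"
    have "d = Qu k (xinf - u k) + (?r - M *v (u k - u 0 + Qu k (xinf - u k)))"
      using step[OF kn]
      by (simp add: d_def matrix_vector_mult_diff_distrib matrix_vector_right_distrib)
    also have "\<dots> \<in> ?K (Suc k)"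
    proof (rule subspace_add[OF subspace_krylov_space _ subspace_diff[OF subspace_krylov_space]])
      show "Qu k (xinf - u k) \<in> ?K (Suc k)"
        using is_projection_based_on_galerkin(1)[OF Q] krylov_space_subset_Suc by blast
      show "?r \<in> ?K (Suc k)"
        using power_mem_krylov_space[of 0 "Suc k" M ?r] by simp
      show "M *v (u k - u 0 + Qu k (xinf - u k)) \<in> ?K (Suc k)"
        by (intro mult_mem_krylov_space subspace_add[OF subspace_krylov_space] u0
            is_projection_based_on_galerkin(1)[OF Q])
    qed
    finally have dK: "d \<in> ?K (Suc k)" .
    have Z: "increment_space u (Suc k) = span (insert d (?K k))"
      unfolding increment_space_Suc d_def using IH by simp
    have absorb: "span (insert a (?K k)) = ?K k" if "a \<in> ?K k" for a
      using that by (simp add: insert_absorb span_eq_iff[THEN iffD2, OF subspace_krylov_space])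
    have "increment_space u (Suc k) = ?K (Suc k)"
    proof (cases "d \<in> ?K k")
      case False
      let ?a = "(((*v) M) ^^ k) ?r"
      have "d \<in> span (insert ?a (?K k))" "d \<notin> span (?K k)"
        using dK False unfolding krylov_space_Suc
        by (simp_all add: span_eq_iff[THEN iffD2, OF subspace_krylov_space])
      then have "?a \<in> span (insert d (?K k))"
        by (rule in_span_insert)
      then show ?thesis
        using dK unfolding Z krylov_space_Suc
        by (intro subset_antisym span_minimal subspace_span) (auto intro: span_base)
    next
      case True
      have "(((*v) M) ^^ k) ?r \<in> ?K k"
      proof (rule ccontr)
        assume new: "(((*v) M) ^^ k) ?r \<notin> ?K k"
        have "u (Suc k) = u k"
        proof (rule accelerated_stagnation[of k A L u Qu xinf M])
          show "u (Suc k) - u k \<in> increment_space u k"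
            using True IH by (simp add: d_def)
          show "is_projection_based_on A L (increment_space u j) (Qu j)" if "j \<le> k" for j
            using Qu that kn by simp
          show "u (Suc j) = u j + Qu j (xinf - u j) + M *v ((xinf - u j) - Qu j (xinf - u j))"
            if "j \<le> k" for j
            using that kn by (intro step) simp
        qed (use IH new in simp_all)
        then have "u k = xinf" using nostag[OF kn] by simp
        then have "?e \<in> ?K k" using u0 by simp
        then show False
          using new krylov_space_stationary[OF inj] by blast
      qed
      then show ?thesis
        using True by (simp add: Z absorb krylov_space_invariant_step)
    qed
    then show ?thesis using Suc by simp
  qed
qed

theorem proposition7:
  fixes A P :: "real ^ 'n ^ 'n"
    and b x0 xinf :: "real ^ 'n"
    and L :: "real ^ 'n \<Rightarrow> real ^ 'n"
    and n :: nat
    and u v :: "nat \<Rightarrow> real ^ 'n"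
    and Qu :: "nat \<Rightarrow> real ^ 'n \<Rightarrow> real ^ 'n"
    and Qv Qx :: "real ^ 'n \<Rightarrow> real ^ 'n"
    and u_half v_half x_half :: "real ^ 'n"
  assumes "invertible A" and "invertible P"
    and "A *v xinf = b"
    and "linear L"
    and Qu: "\<And>k. k \<le> n \<Longrightarrow> is_projection_based_on A L (increment_space u k) (Qu k)"
    and Qv: "is_projection_based_on A L (increment_space v n) Qv"
    and Qx: "is_projection_based_on A L
               (krylov_space (matrix_inv P ** A) ((matrix_inv P ** A) *v (xinf - x0)) n) Qx"
    and "v 0 = x0" and "u 0 = x0"
    and v_step: "\<And>k. k < n \<Longrightarrow> v (Suc k) = v k + (matrix_inv P ** A) *v (xinf - v k)"
    and u_step: "\<And>k. k < n \<Longrightarrow>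
          u (Suc k) = u k + Qu k (xinf - u k)
            + (matrix_inv P ** A) *v ((xinf - u k) - Qu k (xinf - u k))"
    and "v_half = (v n - Qv (v n)) + Qv xinf"
    and "u_half = (u n - Qu n (u n)) + Qu n xinf"
    and "x_half = (x0 - Qx x0) + Qx xinf"
  \<comment> \<open>If the iteration \<open>u\<close> stagnates before reaching the solution, then
      \<open>u_half = x_half\<close> can fail, even though all projections are well defined: take
      \<open>P = 1\<close>, \<open>A = L\<close> a rotation of the plane by a right angle, \<open>x0 \<noteq> xinf\<close> and
      \<open>n = 2\<close>.  There is no stagnation if the increments of \<open>u\<close> are linearly independent.\<close>
  shows "v_half = x_half \<and>
    ((\<forall>k<n. u (Suc k) = u k \<longrightarrow> u k = xinf) \<longrightarrow> v_half = u_half \<and> u_half = x_half)"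
proof -
  define M where "M = matrix_inv P ** A"
  have "P ** matrix_inv P = mat 1 \<and> matrix_inv P ** P = mat 1"
    using \<open>invertible P\<close> unfolding matrix_inv_def invertible_def by (rule someI_ex)
  then have "invertible (matrix_inv P)"
    unfolding invertible_def by blast
  then have "invertible M"
    unfolding M_def using \<open>invertible A\<close> by (rule invertible_mult)
  then have inj: "inj ((*v) M)"
    by (simp add: inj_matrix_vector_mult)
  let ?K = "krylov_space M (M *v (xinf - x0)) n"
  have same: "(w n - Q (w n)) + Q xinf = x_half"
    if w0: "w 0 = x0" and K: "increment_space w n = ?K"
      and Q: "is_projection_based_on A L (increment_space w n) Q" for w Q
  proof -
    have "Q = Qx"
      using projection_based_on_inj[OF Q] Qx K by (simp add: M_def)
    moreover have "w n - Q (w n) = x0 - Q x0"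
      using correction_cong[OF Q] diff_mem_increment_space[of w n] w0 by simp
    ultimately show ?thesis
      using \<open>x_half = (x0 - Qx x0) + Qx xinf\<close> by simp
  qed
  have "increment_space v n = ?K"
    using richardson_increment_space[of n v M xinf n] v_step \<open>v 0 = x0\<close> by (simp add: M_def)
  then have v: "v_half = x_half"
    using same[OF \<open>v 0 = x0\<close> _ Qv] \<open>v_half = (v n - Qv (v n)) + Qv xinf\<close> by simp
  have "u_half = x_half" if nostag: "\<forall>k<n. u (Suc k) = u k \<longrightarrow> u k = xinf"
  proof -
    have "increment_space u n = krylov_space M (M *v (xinf - u 0)) n"
      by (rule accelerated_increment_space[OF inj Qu])
        (use u_step nostag in \<open>auto simp: M_def\<close>)
    then show ?thesis
      using same[OF \<open>u 0 = x0\<close> _ Qu[of n]] \<open>u 0 = x0\<close> \<open>u_half = (u n - Qu n (u n)) + Qu n xinf\<close>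
      by simp
  qed
  with v show ?thesis by simp
qed

end
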